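(* Let $x$ be a complex number with $x\neq 0$ and $9x^2\neq 1$, fix a square root $\sqrt{9x^2-1}$, and put $\lambda(x)=3x+\sqrt{9x^2-1}$. Then for every integer $n\geq 1$: \begin{gather*} \sum_{k=1}^n{n\choose k}\frac{1+(-1)^{n-k}}{\bigl(\sqrt{9x^2-1}\bigr)^{k-1}}B_{k}(x)=\sum_{k=0}^n{n\choose k}\frac{1-(-1)^{n-k}}{\bigl(\sqrt{9x^2-1}\bigr)^k}C_k(x),\\ \sum_{k=0}^n{n\choose k}\frac{\lambda(x)+(-1)^{n-k}\lambda^{-1}(x)}{\bigl(6x\sqrt{9x^2-1}\bigr)^{k-1}}B_{2k+1}(x)=6x\sum_{k=0}^n{n\choose k}\frac{\lambda(x)-(-1)^{n-k}\lambda^{-1}(x)}{\bigl(6x\sqrt{9x^2-1}\bigr)^k}C_{2k+1}(x),\\ \sum_{k=1}^n{n\choose k}\frac{1+(-1)^{n-k}}{\bigl(6x\sqrt{9x^2-1}\bigr)^{k-1}}B_{2k}(x)=6x\sum_{k=0}^n{n\choose k}\frac{1-(-1)^{n-k}}{\bigl(6x\sqrt{9x^2-1}\bigr)^k}C_{2k}(x),\\ \sum_{k=0}^n{n\choose k}\frac{1+(-1)^{n-k}}{\bigl(6x\sqrt{9x^2-1}\bigr)^{k-1}}B_{2k+1}(x)=6x\sum_{k=0}^n{n\choose k}\frac{\lambda(x)-(-1)^{n-k}\lambda^{-1}(x)}{\bigl(6x\sqrt{9x^2-1}\bigr)^{k}}C_{2k}(x),\\ \sum_{k=1}^n{n\choose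 k}\frac{\lambda(x)+(-1)^{n-k}\lambda^{-1}(x)}{\bigl(6x\sqrt{9x^2-1}\bigr)^{k-1}}B_{2k}(x)=6x\sum_{k=0}^n{n\choose k}\frac{1-(-1)^{n-k}}{\bigl(6x\sqrt{9x^2-1}\bigr)^k}C_{2k+1}(x). \end{gather*}
   Context: The balancing polynomials $B_n(x)$ and Lucas-balancing polynomials $C_n(x)$, $n\geq 0$, are defined by the recurrence $u_n(x)=6xu_{n-1}(x)-u_{n-2}(x)$ for $n\geq 2$, with initial terms $B_0(x)=0$, $B_1(x)=1$ and $C_0(x)=1$, $C_1(x)=3x$. Note $\lambda(x)^{-1}=3x-\sqrt{9x^2-1}$. The same choice of square root is used throughout. The conditions $x\neq0$, $9x^2\neq 1$ only ensure that the denominators are nonzero. *)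

theory Defs
  imports Complex_Main "HOL-Computational_Algebra.Polynomial"
begin

fun balancing_poly :: "nat \<Rightarrow> complex poly" where
  "balancing_poly 0 = 0"
| "balancing_poly (Suc 0) = 1"
| "balancing_poly (Suc (Suc n)) = [:0, 6:] * balancing_poly (Suc n) - balancing_poly n"

fun lucas_balancing_poly :: "nat \<Rightarrow> complex poly" where
  "lucas_balancing_poly 0 = 1"
| "lucas_balancing_poly (Suc 0) = [:0, 3:]"
| "lucas_balancing_poly (Suc (Suc n)) =
     [:0, 6:] * lucas_balancing_poly (Suc n) - lucas_balancing_poly n"

abbreviation B :: "nat \<Rightarrow> complex \<Rightarrow> complex" where
  "B n x \<equiv> poly (balancing_poly n) x"

abbreviation C :: "nat \<Rightarrow> complex \<Rightarrow> complex" where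
  "C n x \<equiv> poly (lucas_balancing_poly n) x"

end

theory Submission imports Defs begin

text \<open>
  By Binet's formulas, each sum is a combination of powers \<open>(u \<plusminus> 1)^n\<close> and \<open>(v \<plusminus> 1)^n\<close>, where
  \<open>u\<close> and \<open>v\<close> are \<open>l^j / D\<close> and \<open>l^(-j) / D\<close> with \<open>j = 1\<close>, \<open>D = s\<close> in the first identity and
  \<open>j = 2\<close>, \<open>D = 6xs\<close> in the others. In both cases \<open>u - v = 2\<close>, i.e. \<open>u - 1 = v + 1\<close>, and this
  makes the two sides agree.
\<close>

text \<open>Both bases \<open>3*x + s\<close> and \<open>3*x - s\<close> are roots of t^2 = 6xt - 1,
  the characteristic equation of the recurrence, so their powers obey it too. Multiplying by
  \<open>2 * s\<close> keeps the formula free of division.\<close>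

lemma binet_balancing:
  fixes x s :: complex
  assumes "s^2 = 9 * x^2 - 1"
  shows "2 * s * B k x = (3*x + s)^k - (3*x - s)^k"
proof (induction k rule: balancing_poly.induct)
  case (3 n)
  have l: "(3*x + s)^2 = 6*x*(3*x + s) - 1" and m: "(3*x - s)^2 = 6*x*(3*x - s) - 1"
    using assms by (simp_all add: power2_eq_square algebra_simps)
  have "2 * s * B (Suc (Suc n)) x = 6*x * (2 * s * B (Suc n) x) - 2 * s * B n x"
    by (simp add: algebra_simps)
  also have "\<dots> = (3*x + s)^n * (6*x*(3*x + s) - 1) - (3*x - s)^n * (6*x*(3*x - s) - 1)"
    unfolding 3 by (simp add: algebra_simps)
  also have "\<dots> = (3*x + s)^Suc (Suc n) - (3*x - s)^Suc (Suc n)"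
    by (simp only: l [symmetric] m [symmetric]) (simp add: power2_eq_square)
  finally show ?case .
qed simp_all

lemma binet_lucas_balancing:
  fixes x s :: complex
  assumes "s^2 = 9 * x^2 - 1"
  shows "2 * C k x = (3*x + s)^k + (3*x - s)^k"
proof (induction k rule: lucas_balancing_poly.induct)
  case (3 n)
  have l: "(3*x + s)^2 = 6*x*(3*x + s) - 1" and m: "(3*x - s)^2 = 6*x*(3*x - s) - 1"
    using assms by (simp_all add: power2_eq_square algebra_simps)
  have "2 * C (Suc (Suc n)) x = 6*x * (2 * C (Suc n) x) - 2 * C n x"
    by (simp add: algebra_simps)
  also have "\<dots> = (3*x + s)^n * (6*x*(3*x + s) - 1) + (3*x - s)^n * (6*x*(3*x - s) - 1)"
    unfolding 3 by (simp add: algebra_simps)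
  also have "\<dots> = (3*x + s)^Suc (Suc n) + (3*x - s)^Suc (Suc n)"
    by (simp only: l [symmetric] m [symmetric]) (simp add: power2_eq_square)
  finally show ?case .
qed simp_all

text \<open>By the binomial theorem the unsigned part sums to powers of \<open>w + 1\<close>, and
  the factor \<open>(-1)^(n-k)\<close> turns them into powers of \<open>w - 1\<close>, for
  \<open>w\<close> either \<open>u\<close> or \<open>v\<close>.\<close>

lemma binomial_sum_two_sign:
  fixes a b p q u v :: "'a::comm_ring_1"
  shows "(\<Sum>k=0..n. of_nat (n choose k) * (a + (-1)^(n-k) * b) * (p * u^k + q * v^k))
    = a * p * (u + 1)^n + a * q * (v + 1)^n + b * p * (u - 1)^n + b * q * (v - 1)^n"
proof -
  have plus: "(w + 1)^n = (\<Sum>k=0..n. of_nat (n choose k) * w^k)" for w :: 'a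
    by (simp add: binomial_ring atLeast0AtMost)
  have minus: "(w - 1)^n = (\<Sum>k=0..n. of_nat (n choose k) * w^k * (-1)^(n-k))" for w :: 'a
    using binomial_ring [of w "-1" n] by (simp add: atLeast0AtMost)
  show ?thesis
    unfolding plus minus
    by (simp add: sum_distrib_left sum.distrib [symmetric] algebra_simps)
qed

text \<open>Common form of all five identities. Since \<open>u - 1 = v + 1\<close>, either side is a
  combination of only three powers: \<open>(u + 1)^n\<close>, \<open>(v + 1)^n\<close> and
  \<open>(v - 1)^n\<close>. The two equations \<open>lead\<close> match the coefficients of the
  outer powers, and \<open>mix\<close> matches that of the shared power
  \<open>(v + 1)^n\<close>.\<close>

lemma binomial_balancing_eq_lucas_balancing:
  fixes x s c a b a' b' :: complex and n j r r' :: nat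
  defines "l \<equiv> 3*x + s" and "m \<equiv> 3*x - s"
  assumes s: "s^2 = 9 * x^2 - 1" and nz: "s \<noteq> 0" "c \<noteq> 0"
    and diff: "l^j - m^j = 2 * (c * s)"
    and lead: "a * l^r = a' * l^r'" "b * m^r = b' * m^r'"
    and mix: "b * l^r + b' * l^r' = a * m^r + a' * m^r'"
  shows "(\<Sum>k=0..n. of_nat (n choose k) * ((a + (-1)^(n-k) * b) / (c*s) powi (int k - 1)) * B (j*k + r) x)
    = c * (\<Sum>k=0..n. of_nat (n choose k) * ((a' - (-1)^(n-k) * b') / (c*s)^k) * C (j*k + r') x)"
    (is "?L = c * ?R")
proof -
  define u v where "u = l^j / (c*s)" and "v = m^j / (c*s)"
  have "u - v = 2"
    using diff nz by (simp add: u_def v_def diff_divide_distrib [symmetric])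
  then have uv: "u - 1 = v + 1"
    by (simp add: algebra_simps)
  \<comment> \<open>The exponent \<open>int k - 1\<close> leaves a surplus factor
    \<open>c*s\<close>, also at \<open>k = 0\<close>; its \<open>s\<close> cancels against the
    \<open>2*s\<close> of Binet's formula, which leaves \<open>c / 2\<close>.\<close>
  have B: "B (j*k + r) x / (c*s) powi (int k - 1) = c / 2 * (l^r * u^k + (- (m^r)) * v^k)" for k
  proof -
    have eq: "B (j*k + r) x = (l^(j*k + r) - m^(j*k + r)) / (2*s)"
      using binet_balancing [OF s, of "j*k + r"] nz by (simp add: l_def m_def field_simps)
    show ?thesis
      unfolding eq using nz by (simp add: u_def v_def power_int_diff power_add power_mult power_divide field_simps)
  qed
  have C: "C (j*k + r') x / (c*s)^k = 1 / 2 * (l^r' * u^k + m^r' * v^k)" for k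
  proof -
    have "C (j*k + r') x = (l^(j*k + r') + m^(j*k + r')) / 2"
      using binet_lucas_balancing [OF s, of "j*k + r'"] by (simp add: l_def m_def field_simps)
    then show ?thesis
      using nz by (simp add: u_def v_def power_add power_mult power_divide field_simps)
  qed
  have "?L = (\<Sum>k=0..n. c / 2 *
      (of_nat (n choose k) * (a + (-1)^(n-k) * b) * (l^r * u^k + (- (m^r)) * v^k)))"
    (is "_ = (\<Sum>k=0..n. ?f k)")
  proof (rule sum.cong [OF refl])
    fix k
    have "of_nat (n choose k) * ((a + (-1)^(n-k) * b) / (c*s) powi (int k - 1)) * B (j*k + r) x
      = of_nat (n choose k) * (a + (-1)^(n-k) * b) * (B (j*k + r) x / (c*s) powi (int k - 1))"
      by simp
    then show "of_nat (n choose k) * ((a + (-1)^(n-k) * b) / (c*s) powi (int k - 1)) * B (j*k + r) x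
      = ?f k"
      unfolding B by (simp only: ac_simps)
  qed
  also have "\<dots> = c / 2 * (a * l^r * (u + 1)^n - a * m^r * (v + 1)^n
      + b * l^r * (v + 1)^n - b * m^r * (v - 1)^n)"
    unfolding sum_distrib_left [symmetric] binomial_sum_two_sign uv by simp
  also have "\<dots> = c / 2 * (a' * l^r' * (u + 1)^n + a' * m^r' * (v + 1)^n
      - b' * l^r' * (v + 1)^n - b' * m^r' * (v - 1)^n)"
  proof -
    have "b * l^r - a * m^r = a' * m^r' - b' * l^r'"
      using mix by (simp add: algebra_simps)
    then have "(b * l^r - a * m^r) * (v + 1)^n = (a' * m^r' - b' * l^r') * (v + 1)^n"
      by (rule arg_cong)
    then have "b * l^r * (v + 1)^n - a * m^r * (v + 1)^n
      = a' * m^r' * (v + 1)^n - b' * l^r' * (v + 1)^n"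
      by (simp only: left_diff_distrib)
    then show ?thesis
      unfolding lead by (simp add: add_diff_eq diff_add_eq add.commute)
  qed
  \<comment> \<open>The expansion is now read backwards, with \<open>- b'\<close> in the role of
    \<open>b\<close> because the Lucas-balancing side carries a minus sign.\<close>
  also have "\<dots> = c * (\<Sum>k=0..n. 1 / 2 *
      (of_nat (n choose k) * (a' + (-1)^(n-k) * (- b')) * (l^r' * u^k + m^r' * v^k)))"
    (is "_ = c * (\<Sum>k=0..n. ?g k)")
    unfolding sum_distrib_left [symmetric] binomial_sum_two_sign uv by simp
  also have "(\<Sum>k=0..n. ?g k) = ?R"
  proof (rule sum.cong [OF refl])
    fix k
    have "of_nat (n choose k) * ((a' - (-1)^(n-k) * b') / (c*s)^k) * C (j*k + r') x
      = of_nat (n choose k) * (a' + (-1)^(n-k) * (- b')) * (C (j*k + r') x / (c*s)^k)"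
      by simp
    then show "?g k
      = of_nat (n choose k) * ((a' - (-1)^(n-k) * b') / (c*s)^k) * C (j*k + r') x"
      unfolding C by (simp only: ac_simps)
  qed
  finally show ?thesis .
qed

theorem theorem5:
  fixes x s l :: complex and n :: nat
  assumes "x \<noteq> 0" and "9 * x^2 \<noteq> 1"
    and "s^2 = 9 * x^2 - 1"
    and "l = 3 * x + s"
    and "n \<ge> 1"
  shows
    "(\<Sum>k=1..n. of_nat (n choose k) * ((1 + (-1)^(n-k)) / s powi (int k - 1)) * B k x)
       = (\<Sum>k=0..n. of_nat (n choose k) * ((1 - (-1)^(n-k)) / s^k) * C k x)
     \<and>
     (\<Sum>k=0..n. of_nat (n choose k) * ((l + (-1)^(n-k) * inverse l) / (6*x*s) powi (int k - 1)) * B (2*k+1) x)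
       = 6 * x * (\<Sum>k=0..n. of_nat (n choose k) * ((l - (-1)^(n-k) * inverse l) / (6*x*s)^k) * C (2*k+1) x)
     \<and>
     (\<Sum>k=1..n. of_nat (n choose k) * ((1 + (-1)^(n-k)) / (6*x*s) powi (int k - 1)) * B (2*k) x)
       = 6 * x * (\<Sum>k=0..n. of_nat (n choose k) * ((1 - (-1)^(n-k)) / (6*x*s)^k) * C (2*k) x)
     \<and>
     (\<Sum>k=0..n. of_nat (n choose k) * ((1 + (-1)^(n-k)) / (6*x*s) powi (int k - 1)) * B (2*k+1) x)
       = 6 * x * (\<Sum>k=0..n. of_nat (n choose k) * ((l - (-1)^(n-k) * inverse l) / (6*x*s)^k) * C (2*k) x)
     \<and>
     (\<Sum>k=1..n. of_nat (n choose k) * ((l + (-1)^(n-k) * inverse l) / (6*x*s) powi (int k - 1)) * B (2*k) x)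
       = 6 * x * (\<Sum>k=0..n. of_nat (n choose k) * ((1 - (-1)^(n-k)) / (6*x*s)^k) * C (2*k+1) x)"
proof -
  define m where "m = 3 * x - s"
  \<comment> \<open>The product is 9x^2 - s^2, so the conjugate \<open>m\<close> is the inverse of
    \<open>l\<close>.\<close>
  have "l * m = 1"
    using assms(3,4) by (simp add: m_def power2_eq_square algebra_simps)
  then have inv: "inverse l = m" "l * m = 1" "m * l = 1"
    by (simp_all add: inverse_unique mult.commute)
  have s: "s \<noteq> 0" and x: "6 * x \<noteq> 0"
    using assms(1-3) by auto
  have diff1: "(3*x + s)^1 - (3*x - s)^1 = 2 * (1 * s)"
    by simp
  \<comment> \<open>Difference of squares: the bases have sum \<open>6*x\<close> and difference
    \<open>2*s\<close>. This is where the factor \<open>6*x\<close> of the last four identities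
    comes from.\<close>
  have diff2: "(3*x + s)^2 - (3*x - s)^2 = 2 * ((6*x) * s)"
    by (simp add: power2_eq_square algebra_simps)
  \<comment> \<open>For the sums that start at 1: there \<open>r = 0\<close>, so the term at
    \<open>k = 0\<close> contains B_0 = 0.\<close>
  have from_one: "(\<Sum>k=1..n. f k) = (\<Sum>k=0..n. f k)" if "f 0 = 0" for f :: "nat \<Rightarrow> complex"
    using that by (simp add: sum.atLeast_Suc_atMost)
  \<comment> \<open>The instantiations below give, in this order, \<open>a\<close>,
    \<open>r\<close>, \<open>a'\<close>, \<open>r'\<close>, \<open>b\<close>, \<open>b'\<close> and
    \<open>n\<close>.\<close>
  note id1 = binomial_balancing_eq_lucas_balancing [OF assms(3) s _ diff1]
  note id2 = binomial_balancing_eq_lucas_balancing [OF assms(3) s x diff2]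
  note lm = assms(4) [symmetric] m_def [symmetric]
  show ?thesis
    unfolding inv(1)
  proof (intro conjI, goal_cases)
    case 1
    show ?case
      using id1 [of 1 0 1 0 1 1 n] by (subst from_one) simp_all
  next
    case 2
    show ?case
      using id2 [of l 1 l 1 m m n] by (simp add: lm inv)
  next
    case 3
    show ?case
      using id2 [of 1 0 1 0 1 1 n] by (subst from_one) simp_all
  next
    \<comment> \<open>The index shift \<open>r = 1\<close> on the left is balanced by the
      coefficients \<open>l\<close> and \<open>m\<close> on the right, and \<open>mix\<close>
      becomes \<open>l + m = m + l\<close>. The last case exchanges the two roles.\<close>
    case 4
    show ?case
      using id2 [of 1 1 l 0 1 m n] by (simp add: lm add.commute [of l m])
  next
    case 5
    show ?case
      using id2 [of l 0 1 1 m 1 n] by (subst from_one) (simp_all add: lm add.commute [of l m])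
  qed
qed

end
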